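(* Let $n\ge 1$ be an integer. 1. The minimal number of short closed sets covering $S^n$ is $n+2$. That is, there exist $n+2$ short closed subsets of $S^n$ whose union is $S^n$, and no family of fewer than $n+2$ short closed subsets of $S^n$ has union $S^n$. 2. If $F_1,\dots,F_{n+2}$ is a family of short closed subsets of $S^n$ which covers $S^n$, i.e. $S^n=\bigcup_{i=1}^{n+2}F_i$, then: (i) $\bigcap_{i=1}^{n+2}F_i=\emptyset$; (ii) $\bigcap_{i\neq j}F_i\neq\emptyset$ for every $j=1,\dots,n+2$ (the intersection being over all $i\in\{1,\dots,n+2\}$ with $i\ne j$); (iii) if $a_j\in\bigcap_{i\neq j}F_i$ for each $j=1,\dots,n+2$, then $a_1,\dots,a_{n+2}$ are the vertices of an $(n+1)$-simplex in $\mathbb{R}^{n+1}$ (in particular they are affinely independent) which contains $0$ in its interior. Moreover, if $F_1,\dots,F_{n+2}$ are caps in $S^n$, then conditions (i) and (ii) are also sufficient for the family to cover $S^n$: if $F_1,\dots,F_{n+2}$ are caps satisfying (i) and (ii), then $S^n=\bigcup_{i=1}^{n+2}F_i$.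
   Context: $\mathbb{R}^{n+1}$ is the $(n+1)$-dimensional Euclidean space with its standard scalar product $\langle\cdot,\cdot\rangle$ and the topology it generates, and $S^n=\{x\in\mathbb{R}^{n+1}:\langle x,x\rangle=1\}$ is the $n$-dimensional unit sphere. A subset of $S^n$ is called short if it is contained in an open hemisphere, i.e. in a set of the form $\{x\in S^n:\langle u,x\rangle>0\}$ for some nonzero $u\in\mathbb{R}^{n+1}$. A subset $C\subset S^n$ is called geodesically convex if together with any two of its points it contains the arc of minimal length, joining these points, of the principal (great) circle of $S^n$ through them. (For a short set, which contains no two antipodal points, this minimal arc is unique.) A cap is a subset of $S^n$ that is short, closed and geodesically convex. *)

theory Defs
  imports "HOL-Analysis.Analysis"
begin

text \<open>
  The unit sphere of a Euclidean space \<open>'a\<close> of dimension \<open>n + 1\<close> is \<open>sphere (0::'a) 1\<close>.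
\<close>

definition open_hemisphere :: "'a::euclidean_space \<Rightarrow> 'a set"
  where "open_hemisphere u = {x \<in> sphere 0 1. u \<bullet> x > 0}"

definition short_set :: "'a::euclidean_space set \<Rightarrow> bool"
  where "short_set A \<longleftrightarrow> (\<exists>u. u \<noteq> 0 \<and> A \<subseteq> open_hemisphere u)"

text \<open>
  For orthonormal \<open>x\<close> and \<open>v\<close>, \<open>t \<mapsto> cos t x + sin t v\<close> is a unit-speed parametrization of the
  great circle \<open>sphere 0 1 \<inter> span {x, v}\<close>.  So \<open>joins_by_arc x y v \<theta>\<close> says that the arc
  \<open>circle_path x v ` {0..\<theta>}\<close> of this great circle, which has length \<open>\<theta>\<close>, starts at \<open>x\<close> and ends
  at \<open>y\<close>.
\<close>

definition circle_path :: "'a::euclidean_space \<Rightarrow> 'a \<Rightarrow> real \<Rightarrow> 'a"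
  where "circle_path x v t = cos t *\<^sub>R x + sin t *\<^sub>R v"

definition joins_by_arc :: "'a::euclidean_space \<Rightarrow> 'a \<Rightarrow> 'a \<Rightarrow> real \<Rightarrow> bool"
  where "joins_by_arc x y v \<theta> \<longleftrightarrow>
    x \<in> sphere 0 1 \<and> v \<in> sphere 0 1 \<and> x \<bullet> v = 0 \<and> 0 \<le> \<theta> \<and> circle_path x v \<theta> = y"

definition minimal_arc :: "'a::euclidean_space \<Rightarrow> 'a \<Rightarrow> 'a set \<Rightarrow> bool"
  where "minimal_arc x y A \<longleftrightarrow>
    (\<exists>v \<theta>. joins_by_arc x y v \<theta> \<and> A = circle_path x v ` {0..\<theta>} \<and>
      (\<forall>w \<phi>. joins_by_arc x y w \<phi> \<longrightarrow> \<theta> \<le> \<phi>))"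

text \<open>
  If \<open>x\<close> and \<open>y\<close> are antipodal, then every great half-circle between them is a minimal arc, and
  all of them are required to lie in the set.  Short sets contain no antipodal points, so this
  choice does not affect caps.
\<close>

definition geodesically_convex :: "'a::euclidean_space set \<Rightarrow> bool"
  where "geodesically_convex C \<longleftrightarrow>
    C \<subseteq> sphere 0 1 \<and> (\<forall>x\<in>C. \<forall>y\<in>C. \<forall>A. minimal_arc x y A \<longrightarrow> A \<subseteq> C)"

definition short_closed :: "'a::euclidean_space set \<Rightarrow> bool"
  where "short_closed A \<longleftrightarrow> short_set A \<and> closedin (top_of_set (sphere 0 1)) A"

definition cap :: "'a::euclidean_space set \<Rightarrow> bool"
  where "cap C \<longleftrightarrow> short_closed C \<and> geodesically_convex C"

end

theory Submission
  imports Defs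
begin

text \<open>
  Let \<open>d\<close> be the dimension of the ambient space, so that a minimal cover has \<open>d + 1\<close> sets.  Choose
  for each set \<open>F i\<close> of a short closed cover a pole \<open>u i\<close> of an open hemisphere around it.  These
  hemispheres cover the sphere as well, so every \<open>x \<noteq> 0\<close> satisfies \<open>u i \<bullet> x > 0\<close> for some \<open>i\<close>; by
  separation this means that \<open>0\<close> is interior to the convex hull of the poles
  (\<open>zero_in_interior_convex_hullI\<close>).  A hull with nonempty interior has more than \<open>d\<close> generators,
  which is the lower bound, and if it has exactly \<open>d + 1\<close> of them they span a simplex.  Conversely,
  any \<open>d + 1\<close> such vectors give a cover: let \<open>F u\<close> consist of the points at which \<open>u \<bullet> x\<close> is largest.

  A common point \<open>x\<close> of all sets is impossible because \<open>- x\<close> would lie outside every hemisphere.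
  That any \<open>d\<close> of the sets meet is the topological part.  For each \<open>j\<close> there is a vector \<open>w j\<close>
  on the negative side of all poles but \<open>u j\<close>.  A convex combination of the \<open>w j\<close> with \<open>j \<in> J\<close>
  is on the negative side of every pole outside \<open>J\<close>, so its direction lies in some
  \<open>F j\<close> with \<open>j \<in> J\<close>.  Hence the radially extended sets satisfy the hypothesis of the
  Knaster--Kuratowski--Mazurkiewicz lemma on the hull of all \<open>w j\<close> with \<open>j \<noteq> k\<close>, and so they meet.
  That lemma is derived from Brouwer's fixed point theorem.

  For points \<open>a j\<close> common to all sets but the \<open>j\<close>-th one, \<open>u i \<bullet> a j > 0\<close> whenever \<open>i \<noteq> j\<close>.  The
  poles satisfy a linear relation with positive coefficients; subtracting a multiple of it, any
  \<open>x \<noteq> 0\<close> becomes a nonnegative combination of the poles that omits one of them, say \<open>u j\<close>, and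
  then \<open>a j \<bullet> x > 0\<close>.  So the \<open>a j\<close> positively span the space too, and form a simplex
  around \<open>0\<close>.

  For caps, geodesic convexity says that the cone over each \<open>F i\<close> is convex.  If a linear relation
  between the points \<open>a j\<close> had a negative coefficient and also a nonnegative one, moving the negative
  terms to the other side would, as in Radon's theorem, produce a nonzero vector in the cones over all
  the sets, although the sets have no common point.  Hence all coefficients of a nontrivial relation have the same strict sign, so any
  \<open>d\<close> of the \<open>a j\<close> form a basis and there is a relation with positive coefficients.  Again every
  \<open>x\<close> is a nonnegative combination omitting some \<open>a j\<close>, and hence lies in the cone over \<open>F j\<close>.
\<close>

section \<open>Vectors that positively span the space\<close>

text \<open>
  If \<open>0\<close> were not interior, a hyperplane would leave the whole hull weakly on one side of \<open>0\<close>,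
  and its normal would contradict the hypothesis.  Separating \<open>0\<close> from the
  interior says nothing when the interior is empty; then the hull lies in a hyperplane instead.
\<close>

lemma zero_in_interior_convex_hullI:
  fixes U :: "'a::euclidean_space set"
  assumes pos: "\<And>x. x \<noteq> 0 \<Longrightarrow> \<exists>u\<in>U. 0 < u \<bullet> x"
  shows "0 \<in> interior (convex hull U)"
proof (rule ccontr)
  assume 0: "0 \<notin> interior (convex hull U)"
  have "\<exists>x. x \<noteq> 0 \<and> (\<forall>y\<in>convex hull U. y \<bullet> x \<le> 0)"
  proof (cases "interior (convex hull U) = {}")
    case True
    then obtain a b where ab: "a \<noteq> 0" "convex hull U \<subseteq> {x. a \<bullet> x = b}"
      using empty_interior_subset_hyperplane[OF convex_convex_hull] by metis
    show ?thesis
    proof (cases "b \<le> 0")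
      case True
      then show ?thesis using ab by (intro exI[of _ a]) (auto simp: inner_commute)
    next
      case False
      then show ?thesis using ab by (intro exI[of _ "-a"]) (auto simp: inner_commute)
    qed
  next
    case False
    obtain a where a: "a \<noteq> 0" "\<forall>x\<in>interior (convex hull U). 0 \<le> a \<bullet> x"
      using separating_hyperplane_set_0[of "interior (convex hull U)"] 0
      by (auto simp: convex_interior)
    have "closure (interior (convex hull U)) \<subseteq> {x. 0 \<le> a \<bullet> x}"
      using a by (intro closure_minimal closed_halfspace_ge) (auto simp: closed_halfspace_ge)
    then have "convex hull U \<subseteq> {x. 0 \<le> a \<bullet> x}"
      using False closure_subset[of "convex hull U"]
      by (auto simp: convex_closure_interior)
    then show ?thesis using a by (intro exI[of _ "-a"]) (auto simp: inner_commute)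
  qed
  then obtain x where "x \<noteq> 0" "\<forall>y\<in>convex hull U. y \<bullet> x \<le> 0" by blast
  with pos[of x] show False using hull_subset[of U convex] by fastforce
qed

lemma card_gt_DIM_if_interior_convex_hull:
  fixes U :: "'a::euclidean_space set"
  assumes "finite U" "interior (convex hull U) \<noteq> {}"
  shows "DIM('a) < card U"
proof -
  have "aff_dim U = DIM('a)"
    using aff_dim_nonempty_interior[OF assms(2)] by (simp add: aff_dim_convex_hull)
  with aff_dim_le_card[OF assms(1)] show ?thesis by linarith
qed

lemma simplex_if_interior_convex_hull:
  fixes u :: "'i \<Rightarrow> 'a::euclidean_space"
  assumes I: "finite I" "card I = DIM('a) + 1"
    and ne: "interior (convex hull (u ` I)) \<noteq> {}"
  shows "inj_on u I" and "\<not> affine_dependent (u ` I)"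
proof -
  have "card (u ` I) = card I"
    using card_gt_DIM_if_interior_convex_hull[OF _ ne] card_image_le[OF I(1), of u] I by simp
  then show "inj_on u I" using I(1) by (simp add: eq_card_imp_inj_on)
  have "aff_dim (u ` I) = DIM('a)"
    using aff_dim_nonempty_interior[OF ne] by (simp add: aff_dim_convex_hull)
  then show "\<not> affine_dependent (u ` I)"
    using I \<open>card (u ` I) = card I\<close> by (simp add: affine_independent_iff_card)
qed

text \<open>
  Subtract the largest multiple of the positive relation that keeps all coefficients nonnegative.
  The ratio \<open>d i / l i\<close> tells which coefficient vanishes first.
\<close>

lemma conic_combination_omitting_one:
  fixes v :: "'i \<Rightarrow> 'a::real_vector"
  assumes I: "finite I" "I \<noteq> {}"
    and l: "\<And>i. i \<in> I \<Longrightarrow> 0 < l i" "(\<Sum>i\<in>I. l i *\<^sub>R v i) = 0"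
    and x: "x = (\<Sum>i\<in>I. d i *\<^sub>R v i)"
  obtains c j where "j \<in> I" "\<And>i. i \<in> I \<Longrightarrow> 0 \<le> c i" "c j = (0::real)"
    "x = (\<Sum>i\<in>I. c i *\<^sub>R v i)"
proof -
  obtain j where j: "j \<in> I" "\<And>i. i \<in> I \<Longrightarrow> d j / l j \<le> d i / l i"
    using ex_is_arg_min_if_finite[OF I, of "\<lambda>i. d i / l i"]
    unfolding is_arg_min_linorder by auto
  define c where "c i = d i - d j / l j * l i" for i
  have "x = (\<Sum>i\<in>I. d i *\<^sub>R v i) - (d j / l j) *\<^sub>R (\<Sum>i\<in>I. l i *\<^sub>R v i)"
    using l x by simp
  also have "\<dots> = (\<Sum>i\<in>I. c i *\<^sub>R v i)"
    unfolding c_def scaleR_sum_right sum_subtractf[symmetric]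
    by (rule sum.cong) (auto simp: scaleR_left_diff_distrib)
  finally have "x = (\<Sum>i\<in>I. c i *\<^sub>R v i)" .
  moreover have "0 \<le> c i" if "i \<in> I" for i
    using j(2)[OF that] l(1)[OF that] by (simp add: c_def pos_le_divide_eq)
  moreover have "c j = 0" using l(1)[OF j(1)] by (simp add: c_def)
  ultimately show ?thesis using that j(1) by blast
qed

text \<open>
  Being positively spanning passes from the \<open>u i\<close> to any family \<open>a\<close> for which the matrix of the
  \<open>u i \<bullet> a j\<close> is positive off the diagonal: nothing is known about \<open>u j \<bullet> a j\<close>, and writing \<open>x\<close> as a
  nonnegative combination of the \<open>u i\<close> with \<open>i \<noteq> j\<close> keeps this entry out of \<open>a j \<bullet> x\<close>.
\<close>

lemma dual_family_positively_spans:
  fixes u a :: "'i \<Rightarrow> 'a::euclidean_space"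
  assumes I: "finite I" "card I = DIM('a) + 1"
    and pos: "\<And>x. x \<noteq> 0 \<Longrightarrow> \<exists>i\<in>I. 0 < u i \<bullet> x"
    and ua: "\<And>i j. i \<in> I \<Longrightarrow> j \<in> I \<Longrightarrow> i \<noteq> j \<Longrightarrow> 0 < u i \<bullet> a j"
    and x: "x \<noteq> 0"
  shows "\<exists>j\<in>I. 0 < a j \<bullet> x"
proof -
  have int: "0 \<in> interior (convex hull (u ` I))"
    using pos by (intro zero_in_interior_convex_hullI) auto
  then have ne: "interior (convex hull (u ` I)) \<noteq> {}" by blast
  note inj = simplex_if_interior_convex_hull(1)[OF I ne]
  note indep = simplex_if_interior_convex_hull(2)[OF I ne]
  have "card (u ` I) = Suc (DIM('a))" using I inj by (simp add: card_image)
  then obtain m where m: "\<And>v. v \<in> u ` I \<Longrightarrow> 0 < m v" "(\<Sum>v\<in>u ` I. m v *\<^sub>R v) = 0"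
    using int interior_convex_hull_explicit_minimal[OF indep] by auto
  have "affine hull (u ` I) = UNIV"
    using affine_hull_nonempty_interior[OF ne] by (simp add: affine_hull_convex_hull)
  then have "x \<in> affine hull (u ` I)" by simp
  then obtain d where "x = (\<Sum>v\<in>u ` I. d v *\<^sub>R v)"
    unfolding affine_hull_finite[OF finite_imageI[OF I(1)]] by auto
  then have "x = (\<Sum>i\<in>I. d (u i) *\<^sub>R u i)"
    by (simp add: sum.reindex[OF inj])
  moreover have "(\<Sum>i\<in>I. m (u i) *\<^sub>R u i) = 0"
    using m(2) by (simp add: sum.reindex[OF inj])
  moreover have "I \<noteq> {}" using I by auto
  moreover have "0 < m (u i)" if "i \<in> I" for i using m(1) that by blast
  ultimately obtain c j where c: "j \<in> I" "\<And>i. i \<in> I \<Longrightarrow> 0 \<le> c i" "c j = 0"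
    "x = (\<Sum>i\<in>I. c i *\<^sub>R u i)"
    using conic_combination_omitting_one[OF I(1), of "\<lambda>i. m (u i)" u x "\<lambda>i. d (u i)"]
    by metis
  have "a j \<bullet> x = (\<Sum>i\<in>I. c i * (u i \<bullet> a j))"
    unfolding c(4) by (simp add: inner_sum_right inner_commute)
  moreover have nonneg: "0 \<le> c i * (u i \<bullet> a j)" if "i \<in> I" for i
  proof (cases "i = j")
    case True
    then show ?thesis using c(3) by simp
  next
    case False
    then show ?thesis using c(2)[OF that] ua[OF that c(1) False] by simp
  qed
  moreover have "\<exists>i\<in>I. c i \<noteq> 0"
  proof (rule ccontr)
    assume "\<not> (\<exists>i\<in>I. c i \<noteq> 0)"
    then show False using c(4) x by simp
  qed
  then obtain i where i: "i \<in> I" "c i \<noteq> 0" by blast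
  with c(3) have "i \<noteq> j" by auto
  with c(2)[OF i(1)] i ua[OF i(1) c(1)] have "0 < c i * (u i \<bullet> a j)" by simp
  ultimately show ?thesis
    using c(1) i(1) I(1) sum_pos2[of I i "\<lambda>i. c i * (u i \<bullet> a j)"] by metis
qed

text \<open>
  The remaining vectors are too few for their hull to have interior, so they lie in a hyperplane,
  which cannot pass through \<open>0\<close>: one of its two normals would have nonpositive product with all
  the \<open>u i\<close>, including \<open>u k\<close>.  The normal pointing from \<open>0\<close> away from the hyperplane is the required vector.
\<close>

lemma negative_side_of_all_but_one:
  fixes u :: "'i \<Rightarrow> 'a::euclidean_space"
  assumes I: "finite I" "card I = DIM('a) + 1"
    and pos: "\<And>x. x \<noteq> 0 \<Longrightarrow> \<exists>i\<in>I. 0 < u i \<bullet> x"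
    and k: "k \<in> I"
  shows "\<exists>w. \<forall>i\<in>I - {k}. u i \<bullet> w < 0"
proof -
  have "card (u ` (I - {k})) \<le> DIM('a)"
    using card_image_le[of "I - {k}" u] I k by simp
  then have "interior (convex hull (u ` (I - {k}))) = {}"
    using card_gt_DIM_if_interior_convex_hull[of "u ` (I - {k})"] I(1) by fastforce
  then obtain a b where ab: "a \<noteq> 0" "convex hull (u ` (I - {k})) \<subseteq> {x. a \<bullet> x = b}"
    using empty_interior_subset_hyperplane[OF convex_convex_hull] by metis
  have ua: "u i \<bullet> a = b" if "i \<in> I - {k}" for i
  proof -
    have "u i \<in> convex hull (u ` (I - {k}))" using that by (auto intro: hull_inc)
    then show ?thesis using ab(2) by (auto simp: inner_commute)
  qed
  have "b \<noteq> 0"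
  proof
    assume b: "b = 0"
    define y where "y = (if u k \<bullet> a \<le> 0 then a else - a)"
    have "u i \<bullet> y \<le> 0" if "i \<in> I" for i
      using ua[of i] that b by (cases "i = k") (auto simp: y_def)
    moreover have "y \<noteq> 0" using ab(1) by (simp add: y_def)
    ultimately show False using pos[of y] by fastforce
  qed
  then have "\<forall>i\<in>I - {k}. u i \<bullet> (- (sgn b *\<^sub>R a)) < 0"
    using ua by (auto simp: abs_sgn[symmetric] mult.commute)
  then show ?thesis by blast
qed

section \<open>Closed covers of a sphere by short sets\<close>

text \<open>
  If the sets had no common point in the hull, then weighting each \<open>w i\<close> by the distance to \<open>G i\<close>
  would define a continuous self-map of the hull.  Its fixed point \<open>x\<close> lies in the hull
  of those \<open>w i\<close> for which \<open>x \<notin> G i\<close>, and by hypothesis one of these sets \<open>G i\<close> contains \<open>x\<close>.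
\<close>

lemma Knaster_Kuratowski_Mazurkiewicz:
  fixes w :: "'i \<Rightarrow> 'a::euclidean_space"
  assumes I: "finite I" "I \<noteq> {}"
    and closed: "\<And>i. i \<in> I \<Longrightarrow> closed (G i)"
    and cover: "\<And>J. J \<subseteq> I \<Longrightarrow> convex hull (w ` J) \<subseteq> (\<Union>i\<in>J. G i)"
  shows "(\<Inter>i\<in>I. G i) \<inter> convex hull (w ` I) \<noteq> {}"
proof (rule ccontr)
  assume contra: "\<not> ?thesis"
  let ?K = "convex hull (w ` I)"
  define s where "s x = (\<Sum>i\<in>I. infdist x (G i))" for x
  define f where "f x = (\<Sum>i\<in>I. (infdist x (G i) / s x) *\<^sub>R w i)" for x
  have vertex: "w i \<in> G i" if "i \<in> I" for i
    using cover[of "{i}"] that by auto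
  have zero: "x \<in> G i \<longleftrightarrow> infdist x (G i) = 0" if "i \<in> I" for x i
    using in_closed_iff_infdist_zero[OF closed[OF that]] vertex[OF that] by blast
  have spos: "0 < s x" if x: "x \<in> ?K" for x
  proof -
    obtain i where "i \<in> I" "x \<notin> G i" using contra x by blast
    then have "0 < infdist x (G i)" using zero infdist_nonneg[of x "G i"] by force
    then show ?thesis
      unfolding s_def using I(1) \<open>i \<in> I\<close> by (intro sum_pos2[of _ i]) (auto simp: infdist_nonneg)
  qed
  have weights: "(\<Sum>i\<in>J. infdist x (G i) / s x) = 1"
    if "x \<in> ?K" "J \<subseteq> I" "\<And>i. i \<in> I - J \<Longrightarrow> infdist x (G i) = 0" for x J
  proof -
    have "(\<Sum>i\<in>J. infdist x (G i)) = s x"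
      unfolding s_def using that I(1) by (intro sum.mono_neutral_left) auto
    then show ?thesis using spos[OF that(1)] by (simp add: sum_divide_distrib[symmetric])
  qed
  have hull: "f x \<in> convex hull (w ` J)"
    if x: "x \<in> ?K" and J: "J \<subseteq> I" "\<And>i. i \<in> I - J \<Longrightarrow> infdist x (G i) = 0" for x J
  proof -
    have "f x = (\<Sum>i\<in>J. (infdist x (G i) / s x) *\<^sub>R w i)"
      unfolding f_def using J I(1) by (intro sum.mono_neutral_right) auto
    moreover have "\<dots> \<in> convex hull (w ` J)"
      using J(1) I(1) weights[OF that] spos[OF x]
      by (intro convex_sum convex_convex_hull)
        (auto intro: finite_subset hull_inc simp: infdist_nonneg less_imp_le)
    ultimately show ?thesis by simp
  qed
  have "continuous_on ?K f"
  proof -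
    have "continuous_on ?K s" unfolding s_def by (intro continuous_intros)
    moreover have "\<forall>x\<in>?K. s x \<noteq> 0" using spos by force
    ultimately show ?thesis unfolding f_def by (intro continuous_intros) auto
  qed
  moreover have "f \<in> ?K \<rightarrow> ?K" using hull[of _ I] by auto
  moreover have "compact ?K" using I(1) by (simp add: finite_imp_compact_convex_hull)
  ultimately obtain x where x: "x \<in> ?K" "f x = x"
    using brouwer[of ?K f] I(2) by auto
  let ?J = "{i\<in>I. x \<notin> G i}"
  have "x \<in> convex hull (w ` ?J)"
    using hull[OF x(1), of ?J] x(2) zero by auto
  with cover[of ?J] show False by auto
qed

lemma poles_of_short_closed_cover:
  assumes "\<And>i. i \<in> I \<Longrightarrow> short_closed (F i)" "(\<Union>i\<in>I. F i) = sphere 0 1"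
  obtains u :: "'i \<Rightarrow> 'a::euclidean_space"
  where "\<And>i x. i \<in> I \<Longrightarrow> x \<in> F i \<Longrightarrow> 0 < u i \<bullet> x"
    and "\<And>x. x \<noteq> 0 \<Longrightarrow> \<exists>i\<in>I. 0 < u i \<bullet> x"
proof -
  have "\<forall>i\<in>I. \<exists>u. \<forall>x\<in>F i. 0 < u \<bullet> x"
    using assms(1) unfolding short_closed_def short_set_def open_hemisphere_def by blast
  then obtain u where u: "\<And>i x. i \<in> I \<Longrightarrow> x \<in> F i \<Longrightarrow> 0 < u i \<bullet> x" by metis
  have "\<exists>i\<in>I. 0 < u i \<bullet> x" if "x \<noteq> 0" for x
  proof -
    have "sgn x \<in> sphere 0 1" using that by (simp add: norm_sgn)
    then obtain i where "i \<in> I" "sgn x \<in> F i" using assms(2) by blast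
    then show ?thesis using u[of i "sgn x"] that
      by (auto simp: sgn_div_norm zero_less_mult_iff)
  qed
  with u that show ?thesis by blast
qed

lemma short_closed_cover_card:
  fixes \<F> :: "'a::euclidean_space set set"
  assumes "finite \<F>" "\<And>A. A \<in> \<F> \<Longrightarrow> short_closed A" "\<Union>\<F> = sphere 0 1"
  shows "DIM('a) + 1 \<le> card \<F>"
proof (rule poles_of_short_closed_cover[where F = "\<lambda>A. A" and I = \<F>])
  show "short_closed A" if "A \<in> \<F>" for A by (rule assms(2)[OF that])
  show "(\<Union>A\<in>\<F>. A) = sphere 0 1" using assms(3) by simp
  fix u :: "'a set \<Rightarrow> 'a"
  assume "\<And>x. x \<noteq> 0 \<Longrightarrow> \<exists>A\<in>\<F>. 0 < u A \<bullet> x"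
  then have "0 \<in> interior (convex hull (u ` \<F>))"
    by (intro zero_in_interior_convex_hullI) auto
  then have "DIM('a) < card (u ` \<F>)"
    using assms(1) by (intro card_gt_DIM_if_interior_convex_hull) auto
  then show "DIM('a) + 1 \<le> card \<F>" using card_image_le[OF assms(1), of u] by simp
qed

lemma exists_short_closed_cover:
  "\<exists>\<F> :: 'a::euclidean_space set set. finite \<F> \<and> card \<F> = DIM('a) + 1 \<and>
    (\<forall>A\<in>\<F>. short_closed A) \<and> \<Union>\<F> = sphere 0 1"
proof -
  (* The basis vectors and the negative of their sum are the vertices of a simplex around 0. *)
  define U :: "'a set" where "U = insert (- \<Sum>Basis) Basis"
  define F where "F u = {x \<in> sphere 0 1. \<forall>v\<in>U. v \<bullet> x \<le> u \<bullet> x}" for u :: 'a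
  have U: "finite U" "card U \<le> DIM('a) + 1" "U \<noteq> {}"
    by (auto simp: U_def card_insert_if)
  have pos: "\<exists>u\<in>U. 0 < u \<bullet> x" if "x \<noteq> 0" for x
  proof (rule ccontr)
    assume "\<not> ?thesis"
    then have le: "\<And>b. b \<in> Basis \<Longrightarrow> b \<bullet> x \<le> 0" and "0 \<le> (\<Sum>b\<in>Basis. b \<bullet> x)"
      by (auto simp: U_def inner_sum_left not_less)
    moreover have "(\<Sum>b\<in>Basis. b \<bullet> x) \<le> 0" using le by (rule sum_nonpos)
    ultimately have "(\<Sum>b\<in>Basis. - (b \<bullet> x)) = 0" by (simp add: sum_negf)
    then have "\<forall>b\<in>Basis. - (b \<bullet> x) = 0"
      using le by (subst (asm) sum_nonneg_eq_0_iff) auto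
    then show False using that by (auto simp: euclidean_eq_iff[of x 0] inner_commute)
  qed
  have short: "short_closed (F u)" for u
  proof -
    have hemi: "0 < u \<bullet> x" if x: "x \<in> F u" for x
    proof -
      have "x \<noteq> 0" using x by (auto simp: F_def)
      then obtain v where "v \<in> U" "0 < v \<bullet> x" using pos by blast
      then show ?thesis using x by (fastforce simp: F_def)
    qed
    (* An empty set must still be placed in a hemisphere with a nonzero pole. *)
    have "short_set (F u)"
    proof (cases "F u = {}")
      case True
      obtain b :: 'a where "b \<in> Basis" using nonempty_Basis by blast
      then show ?thesis using True by (auto simp: short_set_def intro!: exI[of _ b])
    next
      case False
      then have "u \<noteq> 0" using hemi by fastforce
      then show ?thesis
        unfolding short_set_def open_hemisphere_def using hemi by (auto simp: F_def)
    qed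
    moreover have "F u = sphere 0 1 \<inter> (\<Inter>v\<in>U. {x. v \<bullet> x \<le> u \<bullet> x})"
      using U(3) by (auto simp: F_def)
    then have "closedin (top_of_set (sphere 0 1)) (F u)"
      by (auto intro!: closedin_closed_Int closed_INT closed_Collect_le continuous_intros)
    ultimately show ?thesis by (simp add: short_closed_def)
  qed
  have cover: "\<Union>(F ` U) = sphere 0 1"
  proof
    show "\<Union>(F ` U) \<subseteq> sphere 0 1" by (auto simp: F_def)
    show "sphere 0 1 \<subseteq> \<Union>(F ` U)"
    proof
      fix x :: 'a assume x: "x \<in> sphere 0 1"
      obtain u where "u \<in> U" "\<forall>v\<in>U. v \<bullet> x \<le> u \<bullet> x"
        using ex_is_arg_min_if_finite[OF U(1,3), of "\<lambda>v. - (v \<bullet> x)"]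
        unfolding is_arg_min_linorder by auto
      then show "x \<in> \<Union>(F ` U)" using x by (auto simp: F_def)
    qed
  qed
  (* The lower bound also shows that different vertices have different sets. *)
  have "card (F ` U) = DIM('a) + 1"
    using short_closed_cover_card[of "F ` U"] card_image_le[OF U(1), of F] U short cover by force
  with U(1) short cover show ?thesis by blast
qed

text \<open>
  A point lying in all sets has its antipode outside all hemispheres containing them.
\<close>

lemma short_closed_cover_Int_empty:
  assumes "\<And>i. i \<in> I \<Longrightarrow> short_closed (F i)" "(\<Union>i\<in>I. F i) = sphere (0::'a::euclidean_space) 1"
  shows "(\<Inter>i\<in>I. F i) = {}"
proof (rule ccontr)
  assume "\<not> ?thesis"
  then obtain x where x: "\<And>i. i \<in> I \<Longrightarrow> x \<in> F i" by blast
  obtain u where u: "\<And>i x. i \<in> I \<Longrightarrow> x \<in> F i \<Longrightarrow> 0 < u i \<bullet> x"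
    and pos: "\<And>x. x \<noteq> 0 \<Longrightarrow> \<exists>i\<in>I. 0 < u i \<bullet> x"
    using poles_of_short_closed_cover[OF assms] by blast
  have "x \<noteq> 0"
  proof
    assume "x = 0"
    obtain b :: 'a where "b \<in> Basis" using nonempty_Basis by blast
    then have "b \<noteq> 0" by auto
    then obtain i where "i \<in> I" using pos by blast
    then show False using u[OF _ x] \<open>x = 0\<close> by fastforce
  qed
  then obtain i where "i \<in> I" "0 < u i \<bullet> (- x)" using pos[of "- x"] by auto
  with u[OF _ x] show False by fastforce
qed

text \<open>
  The vectors \<open>w j\<close> with \<open>j \<noteq> k\<close> are the vertices to which the covering lemma applies: a point in the
  hull of some of them is on the negative side of the poles of all other sets, so only the sets
  belonging to these vertices can contain its direction.  All of the hull is on the negative side of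
  \<open>u k\<close>, and so it avoids \<open>0\<close>.
\<close>

lemma short_closed_cover_Int_all_but_one:
  fixes F :: "'i \<Rightarrow> 'a::euclidean_space set"
  assumes I: "finite I" "card I = DIM('a) + 1"
    and short: "\<And>i. i \<in> I \<Longrightarrow> short_closed (F i)"
    and cover: "(\<Union>i\<in>I. F i) = sphere 0 1"
    and k: "k \<in> I"
  shows "(\<Inter>i\<in>I - {k}. F i) \<noteq> {}"
proof -
  obtain u where u: "\<And>i x. i \<in> I \<Longrightarrow> x \<in> F i \<Longrightarrow> 0 < u i \<bullet> x"
    and pos: "\<And>x. x \<noteq> 0 \<Longrightarrow> \<exists>i\<in>I. 0 < u i \<bullet> x"
    using poles_of_short_closed_cover[OF short cover] by blast
  have "\<forall>j\<in>I. \<exists>w. \<forall>i\<in>I - {j}. u i \<bullet> w < 0"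
    using negative_side_of_all_but_one[OF I pos] by blast
  then obtain w where w: "\<And>i j. j \<in> I \<Longrightarrow> i \<in> I \<Longrightarrow> i \<noteq> j \<Longrightarrow> u i \<bullet> w j < 0"
    by (metis DiffI singletonD)
  have face: "u i \<bullet> x < 0" if "J \<subseteq> I" "i \<in> I - J" "x \<in> convex hull (w ` J)" for i J x
  proof -
    have "convex hull (w ` J) \<subseteq> {x. u i \<bullet> x < 0}"
      using that(1,2) w by (intro hull_minimal convex_halfspace_lt) auto
    then show ?thesis using that(3) by blast
  qed
  let ?K = "convex hull (w ` (I - {k}))"
  (* The hull avoids 0, so radial projection to the sphere is continuous on it. *)
  define G where "G i = {x \<in> ?K. sgn x \<in> F i}" for i
  have nz: "x \<noteq> 0" if "x \<in> ?K" for x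
    using face[of "I - {k}" k x] k that by auto
  have "closed (G i)" if "i \<in> I" for i
  proof -
    have "closed (F i)"
      using short[OF that] unfolding short_closed_def
      by (auto intro: closedin_closed_trans)
    moreover have "closed ?K"
      using I(1) by (simp add: finite_imp_compact_convex_hull compact_imp_closed)
    moreover have "continuous_on ?K sgn"
      unfolding sgn_div_norm using nz by (auto intro!: continuous_intros)
    ultimately have "closed (?K \<inter> sgn -` F i)"
      by (intro continuous_closed_preimage)
    then show ?thesis by (simp add: G_def vimage_def Int_def)
  qed
  moreover have "convex hull (w ` J) \<subseteq> (\<Union>i\<in>J. G i)" if J: "J \<subseteq> I - {k}" for J
  proof
    fix x assume x: "x \<in> convex hull (w ` J)"
    then have xK: "x \<in> ?K" using hull_mono[of "w ` J" "w ` (I - {k})" convex] J by blast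
    have "sgn x \<in> sphere 0 1" using nz[OF xK] by (simp add: norm_sgn)
    then obtain i where i: "i \<in> I" "sgn x \<in> F i" using cover by blast
    have "0 < u i \<bullet> x"
      using u[OF i] nz[OF xK] by (simp add: sgn_div_norm zero_less_mult_iff)
    then have "i \<in> J" using face[of J i x] J i(1) x by fastforce
    then show "x \<in> (\<Union>i\<in>J. G i)" using i xK by (auto simp: G_def)
  qed
  moreover have "I - {k} \<noteq> {}"
  proof
    assume "I - {k} = {}"
    then have "card I \<le> card {k}" by (intro card_mono) auto
    then show False using I(2) DIM_positive[where 'a='a] by simp
  qed
  ultimately have "(\<Inter>i\<in>I - {k}. G i) \<inter> ?K \<noteq> {}"
    using I(1) by (intro Knaster_Kuratowski_Mazurkiewicz) auto
  then obtain x where "\<And>i. i \<in> I - {k} \<Longrightarrow> x \<in> G i" by blast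
  then have "sgn x \<in> (\<Inter>i\<in>I - {k}. F i)" by (auto simp: G_def)
  then show ?thesis by blast
qed

lemma short_closed_cover_simplex:
  fixes F :: "'i \<Rightarrow> 'a::euclidean_space set"
  assumes I: "finite I" "card I = DIM('a) + 1"
    and short: "\<And>i. i \<in> I \<Longrightarrow> short_closed (F i)"
    and cover: "(\<Union>i\<in>I. F i) = sphere 0 1"
    and a: "\<And>j. j \<in> I \<Longrightarrow> a j \<in> (\<Inter>i\<in>I - {j}. F i)"
  shows "inj_on a I" "\<not> affine_dependent (a ` I)"
    "int DIM('a) simplex (convex hull (a ` I))" "0 \<in> interior (convex hull (a ` I))"
proof -
  obtain u where u: "\<And>i x. i \<in> I \<Longrightarrow> x \<in> F i \<Longrightarrow> 0 < u i \<bullet> x"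
    and pos: "\<And>x. x \<noteq> 0 \<Longrightarrow> \<exists>i\<in>I. 0 < u i \<bullet> x"
    using poles_of_short_closed_cover[OF short cover] by blast
  have "\<exists>j\<in>I. 0 < a j \<bullet> x" if "x \<noteq> 0" for x
    using dual_family_positively_spans[OF I pos _ that, of a] u a by blast
  then show int: "0 \<in> interior (convex hull (a ` I))"
    by (intro zero_in_interior_convex_hullI) auto
  then have ne: "interior (convex hull (a ` I)) \<noteq> {}" by blast
  show inj: "inj_on a I" and indep: "\<not> affine_dependent (a ` I)"
    using simplex_if_interior_convex_hull[OF I ne] by auto
  show "int DIM('a) simplex (convex hull (a ` I))"
    unfolding simplex_def using indep I(2) inj by (intro exI[of _ "a ` I"]) (auto simp: card_image)
qed

section \<open>Caps\<close>

text \<open>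
  Orthonormalising \<open>y\<close> against \<open>x\<close> gives the direction \<open>v\<close> of the minimal arc, whose length is
  \<open>arccos (x \<bullet> y)\<close>.  The normalised combination lies at the angle whose cosine is its product with
  \<open>x\<close>, and the triangle inequality shows that this cosine is at least \<open>x \<bullet> y\<close>.
\<close>

lemma sgn_combination_in_minimal_arc:
  fixes x y :: "'a::euclidean_space"
  assumes xy: "x \<in> sphere 0 1" "y \<in> sphere 0 1" "x \<noteq> y" "x \<noteq> - y"
    and st: "0 < s" "0 < t"
  obtains A where "minimal_arc x y A" "sgn (s *\<^sub>R x + t *\<^sub>R y) \<in> A"
proof -
  define c where "c = x \<bullet> y"
  have n: "x \<bullet> x = 1" "y \<bullet> y = 1" "y \<bullet> x = c" "x \<bullet> y = c"
    using xy by (auto simp: c_def norm_eq_1 inner_commute)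
  have "\<bar>c\<bar> < 1"
  proof -
    have "0 < (x - y) \<bullet> (x - y)" "0 < (x + y) \<bullet> (x + y)"
      using xy(3,4) by (auto simp: inner_gt_zero_iff add_eq_0_iff2)
    then show ?thesis using n by (simp add: inner_simps)
  qed
  then have c: "-1 < c" "c < 1" by auto
  define d where "d = sqrt (1 - c\<^sup>2)"
  have d: "0 < d" "d\<^sup>2 = 1 - c\<^sup>2"
    using c by (auto simp: d_def abs_square_less_1 abs_square_le_1 less_imp_le abs_less_iff)
  define v where "v = (y - c *\<^sub>R x) /\<^sub>R d"
  have y: "y = c *\<^sub>R x + d *\<^sub>R v" using d(1) by (simp add: v_def)
  have xv: "x \<bullet> v = 0" using n by (simp add: v_def inner_simps)
  have vv: "v \<bullet> v = 1"
  proof -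
    have "v \<bullet> v = (1 - c\<^sup>2) / d\<^sup>2"
      using n by (simp add: v_def inner_simps power2_eq_square divide_simps)
    moreover have "d\<^sup>2 \<noteq> 0" using d(1) by simp
    ultimately show ?thesis unfolding d(2)[symmetric] by simp
  qed
  have on: "circle_path x v (arccos e) = e *\<^sub>R x + f *\<^sub>R v" if "e\<^sup>2 + f\<^sup>2 = 1" "0 \<le> f" for e f
  proof -
    have "e\<^sup>2 \<le> 1" using that(1) zero_le_power2[of f] by linarith
    then have "\<bar>e\<bar> \<le> 1" by (simp add: abs_square_le_1)
    then have "-1 \<le> e" "e \<le> 1" by auto
    moreover have "sqrt (1 - e\<^sup>2) = f" using that by (intro real_sqrt_unique) auto
    ultimately show ?thesis by (simp add: circle_path_def sin_arccos)
  qed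
  let ?A = "circle_path x v ` {0..arccos c}"
  have "minimal_arc x y ?A"
    unfolding minimal_arc_def
  proof (intro exI conjI allI impI)
    show "joins_by_arc x y v (arccos c)"
      unfolding joins_by_arc_def using xy(1) vv xv c d on[of c d] y
      by (auto simp: norm_eq_1 arccos_lbound)
    fix w \<phi> assume "joins_by_arc x y w \<phi>"
    then have w: "0 \<le> \<phi>" "x \<bullet> w = 0" "y = cos \<phi> *\<^sub>R x + sin \<phi> *\<^sub>R w"
      by (auto simp: joins_by_arc_def circle_path_def)
    have cos: "c = cos \<phi>" unfolding c_def w(3) using n(1) w(2) by (simp add: inner_simps)
    show "arccos c \<le> \<phi>"
    proof (cases "\<phi> \<le> pi")
      case True
      then show ?thesis using w(1) cos by (simp add: arccos_cos)
    next
      case False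
      then show ?thesis using arccos_ubound[of c] c by linarith
    qed
  qed simp
  moreover have "sgn (s *\<^sub>R x + t *\<^sub>R y) \<in> ?A"
  proof -
    define r where "r = norm (s *\<^sub>R x + t *\<^sub>R y)"
    have eq: "s *\<^sub>R x + t *\<^sub>R y = (s + t * c) *\<^sub>R x + (t * d) *\<^sub>R v"
      unfolding y by (simp add: algebra_simps)
    have rr: "r\<^sup>2 = (s + t * c)\<^sup>2 + (t * d)\<^sup>2"
      unfolding r_def eq power2_norm_eq_inner using n(1) xv vv
      by (simp add: inner_simps inner_commute power2_eq_square)
    moreover have "0 < (t * d)\<^sup>2" using d(1) st by simp
    ultimately have "0 < r\<^sup>2" using zero_le_power2[of "s + t * c"] by linarith
    then have r: "0 < r" by (simp add: r_def)
    define e f where "e = (s + t * c) / r" and "f = t * d / r"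
    have ef: "e\<^sup>2 + f\<^sup>2 = 1"
    proof -
      have "e\<^sup>2 + f\<^sup>2 = r\<^sup>2 / r\<^sup>2"
        unfolding rr e_def f_def power_divide add_divide_distrib[symmetric] ..
      then show ?thesis using r by simp
    qed
    have f: "0 \<le> f" using st d(1) r by (simp add: f_def)
    have "sgn (s *\<^sub>R x + t *\<^sub>R y) = (1 / r) *\<^sub>R ((s + t * c) *\<^sub>R x + (t * d) *\<^sub>R v)"
      unfolding sgn_div_norm r_def[symmetric] inverse_eq_divide unfolding eq ..
    also have "\<dots> = e *\<^sub>R x + f *\<^sub>R v"
      by (simp add: e_def f_def scaleR_add_right)
    finally have z: "sgn (s *\<^sub>R x + t *\<^sub>R y) = circle_path x v (arccos e)"
      using on[OF ef f] by simp
    have nx: "norm x = 1" "norm y = 1" using xy by auto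
    have "r \<le> s + t"
      using norm_triangle_ineq[of "s *\<^sub>R x" "t *\<^sub>R y"] st nx by (simp add: r_def)
    moreover have "t - s \<le> r"
      using norm_diff_ineq[of "t *\<^sub>R y" "s *\<^sub>R x"] st nx by (simp add: r_def add.commute)
    ultimately have "c * (r - t) \<le> s"
    proof (cases "0 \<le> c")
      case True
      then have "c * (r - t) \<le> c * s" using \<open>r \<le> s + t\<close> by (intro mult_left_mono) auto
      also have "\<dots> \<le> 1 * s" using c st by (intro mult_right_mono) auto
      finally show ?thesis by simp
    next
      case False
      then have "(- c) * (t - r) \<le> (- c) * s" using \<open>t - s \<le> r\<close> by (intro mult_left_mono) auto
      also have "\<dots> \<le> 1 * s" using c st by (intro mult_right_mono) auto
      finally show ?thesis by (simp add: algebra_simps)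
    qed
    then have "c \<le> e" using r by (simp add: e_def pos_le_divide_eq algebra_simps)
    moreover have "e\<^sup>2 \<le> 1" using ef zero_le_power2[of f] by linarith
    then have "\<bar>e\<bar> \<le> 1" by (simp add: abs_square_le_1)
    ultimately have "0 \<le> arccos e" "arccos e \<le> arccos c"
      using c by (auto intro!: arccos_lbound arccos_le_arccos)
    then show ?thesis unfolding z by auto
  qed
  ultimately show ?thesis using that by blast
qed

lemma cap_sgn_combination:
  fixes x y :: "'a::euclidean_space"
  assumes C: "cap C" and xy: "x \<in> C" "y \<in> C" and st: "0 < s" "0 < t"
  shows "sgn (s *\<^sub>R x + t *\<^sub>R y) \<in> C"
proof (cases "x = y")
  case True
  have "norm x = 1"
    using C xy by (auto simp: cap_def geodesically_convex_def)
  then have "sgn (s *\<^sub>R x + t *\<^sub>R y) = x"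
    using st unfolding True[symmetric] scaleR_left_distrib[symmetric] sgn_scaleR
    by (simp add: sgn_div_norm)
  then show ?thesis using xy by simp
next
  case False
  obtain u where u: "\<And>z. z \<in> C \<Longrightarrow> 0 < u \<bullet> z"
    using C unfolding cap_def short_closed_def short_set_def open_hemisphere_def by blast
  have "x \<noteq> - y" using u[OF xy(1)] u[OF xy(2)] by auto
  moreover have "x \<in> sphere 0 1" "y \<in> sphere 0 1"
    using C xy by (auto simp: cap_def geodesically_convex_def)
  ultimately obtain A where "minimal_arc x y A" "sgn (s *\<^sub>R x + t *\<^sub>R y) \<in> A"
    using sgn_combination_in_minimal_arc[of x y s t] False st by blast
  then show ?thesis using C xy unfolding cap_def geodesically_convex_def by blast
qed

text \<open>
  The cone over a cap is convex and pointed.  Pointedness comes from shortness, since all generators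
  are strictly on the positive side of one hyperplane.
\<close>

lemma cap_conic_combination:
  fixes a :: "'i \<Rightarrow> 'a::euclidean_space"
  assumes C: "cap C" and J: "finite J" "\<And>i. i \<in> J \<Longrightarrow> a i \<in> C" "\<And>i. i \<in> J \<Longrightarrow> 0 \<le> c i"
    and nz: "\<exists>i\<in>J. c i \<noteq> 0"
  shows "(\<Sum>i\<in>J. c i *\<^sub>R a i) \<noteq> 0 \<and> sgn (\<Sum>i\<in>J. c i *\<^sub>R a i) \<in> C"
proof
  obtain u where u: "\<And>z. z \<in> C \<Longrightarrow> 0 < u \<bullet> z"
    using C unfolding cap_def short_closed_def short_set_def open_hemisphere_def by blast
  obtain k where k: "k \<in> J" "c k \<noteq> 0" using nz by blast
  have "0 < (\<Sum>i\<in>J. c i * (u \<bullet> a i))"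
  proof (rule sum_pos2[OF J(1) k(1)])
    show "0 < c k * (u \<bullet> a k)" using J(2,3)[OF k(1)] k(2) u by simp
    show "0 \<le> c i * (u \<bullet> a i)" if "i \<in> J" for i
      using J(3)[OF that] u[OF J(2)[OF that]] by simp
  qed
  then have "0 < u \<bullet> (\<Sum>i\<in>J. c i *\<^sub>R a i)" by (simp add: inner_sum_right)
  then show ne: "(\<Sum>i\<in>J. c i *\<^sub>R a i) \<noteq> 0" by auto
  have "(\<Sum>i\<in>J. c i *\<^sub>R a i) = 0 \<or> sgn (\<Sum>i\<in>J. c i *\<^sub>R a i) \<in> C"
    using J
  proof (induction J rule: finite_induct)
    case empty
    then show ?case by simp
  next
    case (insert i J)
    let ?z = "\<Sum>i\<in>J. c i *\<^sub>R a i"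
    have ai: "a i \<in> C" "0 \<le> c i" using insert.prems by auto
    have norm: "norm (a i) = 1"
      using C ai(1) by (auto simp: cap_def geodesically_convex_def)
    consider "c i = 0" | "0 < c i" "?z = 0" | "0 < c i" "?z \<noteq> 0" using ai(2) by fastforce
    then show ?case
    proof cases
      case 1
      then show ?thesis using insert by simp
    next
      case 2
      then show ?thesis using insert.hyps ai norm by (simp add: sgn_scaleR) (simp add: sgn_div_norm)
    next
      case 3
      then have "sgn ?z \<in> C" using insert.IH insert.prems by auto
      then have "sgn (c i *\<^sub>R a i + norm ?z *\<^sub>R sgn ?z) \<in> C"
        by (rule cap_sgn_combination[OF C ai(1) _ 3(1)]) (use 3(2) in simp)
      moreover have "norm ?z *\<^sub>R sgn ?z = ?z"
        by (simp only: sgn_div_norm scaleR_scaleR) (use 3(2) in simp)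
      ultimately show ?thesis using insert.hyps by simp
    qed
  qed
  with ne show "sgn (\<Sum>i\<in>J. c i *\<^sub>R a i) \<in> C" by blast
qed

text \<open>
  Split the relation as \<open>y = (\<Sum>i\<in>P. c i *\<^sub>R a i) = (\<Sum>i\<in>N. - c i *\<^sub>R a i)\<close> with \<open>P\<close> the
  nonnegative and \<open>N\<close> the negative indices.  Since \<open>a j\<close> lies in all sets but possibly \<open>F j\<close>, the second form puts
  \<open>y\<close> in the cone over \<open>F j\<close> for \<open>j \<in> P\<close>, and the first does so for \<open>j \<in> N\<close>.  If \<open>P\<close> has an
  element, then \<open>y \<noteq> 0\<close> because the cone over that set is pointed, and the direction of \<open>y\<close> is a
  point common to all sets.
\<close>

lemma cap_dependency_same_sign:
  fixes F :: "'i \<Rightarrow> 'a::euclidean_space set"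
  assumes I: "finite I"
    and cap: "\<And>i. i \<in> I \<Longrightarrow> cap (F i)"
    and empty: "(\<Inter>i\<in>I. F i) = {}"
    and a: "\<And>i j. i \<in> I \<Longrightarrow> j \<in> I \<Longrightarrow> i \<noteq> j \<Longrightarrow> a j \<in> F i"
    and dep: "(\<Sum>i\<in>I. c i *\<^sub>R a i) = 0"
    and k: "k \<in> I" "c k < 0"
  shows "\<forall>i\<in>I. c i < 0"
proof -
  define P N where "P = {i\<in>I. 0 \<le> c i}" and "N = {i\<in>I. c i < 0}"
  have fin: "finite P" "finite N" using I by (auto simp: P_def N_def)
  let ?y = "\<Sum>i\<in>N. (- c i) *\<^sub>R a i"
  have "(\<Sum>i\<in>I. c i *\<^sub>R a i) = (\<Sum>i\<in>P. c i *\<^sub>R a i) + (\<Sum>i\<in>N. c i *\<^sub>R a i)"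
    using I by (subst sum.union_disjoint[symmetric])
      (auto simp: P_def N_def intro!: sum.cong)
  then have eq: "?y = (\<Sum>i\<in>P. c i *\<^sub>R a i)"
    using dep by (simp add: sum_negf add_eq_0_iff2)
  have inP: "?y \<noteq> 0 \<and> sgn ?y \<in> F j" if "j \<in> P" for j
  proof (rule cap_conic_combination[OF _ fin(2)])
    show "cap (F j)" using that cap by (simp add: P_def)
    show "a i \<in> F j" if "i \<in> N" for i
      using a[of j i] that \<open>j \<in> P\<close> by (cases "i = j") (auto simp: P_def N_def)
    show "0 \<le> - c i" if "i \<in> N" for i using that by (simp add: N_def)
    show "\<exists>i\<in>N. - c i \<noteq> 0" using k by (intro bexI[of _ k]) (auto simp: N_def)
  qed
  have "P = {}"
  proof (rule ccontr)
    assume "P \<noteq> {}"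
    then have y: "?y \<noteq> 0" using inP by blast
    then have "\<exists>i\<in>P. c i \<noteq> 0" unfolding eq by (metis (no_types, lifting) scaleR_zero_left sum.neutral)
    then have "sgn ?y \<in> F j" if "j \<in> N" for j
      unfolding eq using that fin a cap cap_conic_combination[of "F j" P a c]
      by (fastforce simp: P_def N_def)
    moreover have "I = P \<union> N" by (auto simp: P_def N_def)
    ultimately have "sgn ?y \<in> (\<Inter>i\<in>I. F i)" using inP by blast
    then show False using empty by blast
  qed
  then show ?thesis by (auto simp: P_def)
qed

text \<open>
  Omitting one of the points \<open>a j\<close> leaves a basis, because a relation between the others would have a
  coefficient \<open>0\<close> at the omitted one.  The basis gives both the relation with coefficients of one
  sign and the representation of an arbitrary point from which one generator can be eliminated.
\<close>

lemma caps_cover_sphere: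
  fixes F :: "'i \<Rightarrow> 'a::euclidean_space set"
  assumes I: "finite I" "card I = DIM('a) + 1"
    and cap: "\<And>i. i \<in> I \<Longrightarrow> cap (F i)"
    and empty: "(\<Inter>i\<in>I. F i) = {}"
    and ne: "\<And>j. j \<in> I \<Longrightarrow> (\<Inter>i\<in>I - {j}. F i) \<noteq> {}"
  shows "(\<Union>i\<in>I. F i) = sphere 0 1"
proof
  show "(\<Union>i\<in>I. F i) \<subseteq> sphere 0 1"
    using cap by (auto simp: cap_def geodesically_convex_def)
  define a where "a j = (SOME x. x \<in> (\<Inter>i\<in>I - {j}. F i))" for j
  have "a j \<in> (\<Inter>i\<in>I - {j}. F i)" if "j \<in> I" for j
    unfolding a_def some_in_eq using ne[OF that] .
  then have a: "a j \<in> F i" if "i \<in> I" "j \<in> I" "i \<noteq> j" for i j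
    using that by simp
  have same_sign: "\<forall>i\<in>I. c i < 0"
    if "(\<Sum>i\<in>I. c i *\<^sub>R a i) = 0" "k \<in> I" "c k < 0" for c k
    using cap_dependency_same_sign[OF I(1) cap empty a that] .
  have inj: "inj_on a I"
  proof (rule inj_onI, rule ccontr)
    fix i j assume ij: "i \<in> I" "j \<in> I" "a i = a j" "i \<noteq> j"
    have "a i \<in> F l" if "l \<in> I" for l
      using a[of l i] a[of l j] ij that by (cases "l = i") auto
    then show False using empty by blast
  qed
  obtain k where k: "k \<in> I" using I by fastforce
  let ?J = "I - {k}"
  have injJ: "inj_on a ?J" using inj by (rule inj_on_subset) auto
  have split: "(\<Sum>i\<in>I. g i) = g k + (\<Sum>i\<in>?J. g i)" for g :: "'i \<Rightarrow> 'a"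
    using I(1) k by (simp add: sum.remove)
  have "independent (a ` ?J)"
  proof
    assume "dependent (a ` ?J)"
    then obtain m where m: "\<exists>v\<in>a ` ?J. m v \<noteq> 0" "(\<Sum>v\<in>a ` ?J. m v *\<^sub>R v) = 0"
      using I(1) by (auto simp: dependent_finite)
    then have sum0: "(\<Sum>i\<in>?J. m (a i) *\<^sub>R a i) = 0" by (simp add: sum.reindex[OF injJ])
    obtain i where i: "i \<in> ?J" "m (a i) \<noteq> 0" using m(1) by auto
    (* The sign makes the coefficient at i negative, while the one at k is 0. *)
    define c where "c l = (if l = k then 0 else - sgn (m (a i)) * m (a l))" for l
    have "(\<Sum>l\<in>?J. c l *\<^sub>R a l) = (- sgn (m (a i))) *\<^sub>R (\<Sum>l\<in>?J. m (a l) *\<^sub>R a l)"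
      unfolding scaleR_sum_right by (rule sum.cong) (auto simp: c_def)
    then have "(\<Sum>l\<in>I. c l *\<^sub>R a l) = 0" using sum0 by (simp add: split c_def)
    moreover have "c i < 0" using i by (auto simp: c_def abs_sgn[symmetric] mult.commute)
    ultimately have "\<forall>l\<in>I. c l < 0" using same_sign[of c i] i by blast
    then show False using k by (auto simp: c_def)
  qed
  moreover have "card (a ` ?J) = DIM('a)" using injJ I k by (simp add: card_image)
  ultimately have "UNIV \<subseteq> span (a ` ?J)"
    by (intro card_ge_dim_independent) auto
  then have span: "\<exists>m. x = (\<Sum>i\<in>?J. m i *\<^sub>R a i)" for x
  proof -
    have "x \<in> span (a ` ?J)" using \<open>UNIV \<subseteq> span (a ` ?J)\<close> by blast
    then obtain m where "x = (\<Sum>v\<in>a ` ?J. m v *\<^sub>R v)"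
      using I(1) by (auto simp: span_finite)
    then show ?thesis by (auto simp: sum.reindex[OF injJ] intro: exI[of _ "m \<circ> a"])
  qed
  obtain m where m: "a k = (\<Sum>i\<in>?J. m i *\<^sub>R a i)" using span by blast
  (* Expressing a k in the others is a relation with coefficient -1 at k, so all signs are negative. *)
  define l where "l = m(k := -1)"
  have "(\<Sum>i\<in>?J. l i *\<^sub>R a i) = a k"
    unfolding m by (rule sum.cong) (auto simp: l_def)
  then have dep: "(\<Sum>i\<in>I. l i *\<^sub>R a i) = 0" by (simp add: split l_def)
  have neg: "\<forall>i\<in>I. l i < 0" using same_sign[OF dep k] by (simp add: l_def)
  show "sphere 0 1 \<subseteq> (\<Union>i\<in>I. F i)"
  proof
    fix x :: 'a assume x: "x \<in> sphere 0 1"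
    obtain d where d: "x = (\<Sum>i\<in>?J. d i *\<^sub>R a i)" using span by blast
    have "x = (\<Sum>i\<in>I. (d(k := 0)) i *\<^sub>R a i)"
      unfolding split d by (auto intro: sum.cong)
    moreover have "(\<Sum>i\<in>I. (- l i) *\<^sub>R a i) = 0" using dep by (simp add: sum_negf)
    moreover have "I \<noteq> {}" using k by blast
    moreover have "0 < - l i" if "i \<in> I" for i using neg that by simp
    ultimately obtain c j where c: "j \<in> I" "\<And>i. i \<in> I \<Longrightarrow> 0 \<le> c i" "c j = 0"
      "x = (\<Sum>i\<in>I. c i *\<^sub>R a i)"
      using conic_combination_omitting_one[OF I(1), of "\<lambda>i. - l i" a x "d(k := 0)"]
      by metis
    have xj: "x = (\<Sum>i\<in>I - {j}. c i *\<^sub>R a i)"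
      using I(1) c by (simp add: sum.remove)
    have "x \<noteq> 0" using x by auto
    then have "\<exists>i\<in>I - {j}. c i \<noteq> 0"
      unfolding xj by (metis (no_types, lifting) scaleR_zero_left sum.neutral)
    then have "sgn x \<in> F j"
      unfolding xj using I(1) c cap a
      by (intro conjunct2[OF cap_conic_combination]) auto
    moreover have "sgn x = x" using x by (simp add: sgn_div_norm)
    ultimately show "x \<in> (\<Union>i\<in>I. F i)" using c(1) by auto
  qed
qed

section \<open>Covers by the minimal number of sets\<close>

theorem theorem1:
  fixes n :: nat
  assumes "n \<ge> 1" and "DIM('a::euclidean_space) = n + 1"
  shows
    "(\<exists>\<F> :: 'a set set. finite \<F> \<and> card \<F> = n + 2 \<and>
        (\<forall>A\<in>\<F>. short_closed A) \<and> \<Union>\<F> = sphere 0 1) \<and>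
     (\<forall>\<F> :: 'a set set. finite \<F> \<and> card \<F> < n + 2 \<and>
        (\<forall>A\<in>\<F>. short_closed A) \<longrightarrow> \<Union>\<F> \<noteq> sphere 0 1) \<and>
     (\<forall>F :: nat \<Rightarrow> 'a set.
        (\<forall>i\<in>{1..n+2}. short_closed (F i)) \<and> (\<Union>i\<in>{1..n+2}. F i) = sphere 0 1 \<longrightarrow>
          (\<Inter>i\<in>{1..n+2}. F i) = {} \<and>
          (\<forall>j\<in>{1..n+2}. (\<Inter>i\<in>{1..n+2} - {j}. F i) \<noteq> {}) \<and>
          (\<forall>a :: nat \<Rightarrow> 'a. (\<forall>j\<in>{1..n+2}. a j \<in> (\<Inter>i\<in>{1..n+2} - {j}. F i)) \<longrightarrow>
             inj_on a {1..n+2} \<and>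
             \<not> affine_dependent (a ` {1..n+2}) \<and>
             int (n + 1) simplex (convex hull (a ` {1..n+2})) \<and>
             0 \<in> interior (convex hull (a ` {1..n+2})))) \<and>
     (\<forall>F :: nat \<Rightarrow> 'a set.
        (\<forall>i\<in>{1..n+2}. cap (F i)) \<and>
        (\<Inter>i\<in>{1..n+2}. F i) = {} \<and>
        (\<forall>j\<in>{1..n+2}. (\<Inter>i\<in>{1..n+2} - {j}. F i) \<noteq> {}) \<longrightarrow>
          (\<Union>i\<in>{1..n+2}. F i) = sphere 0 1)"
proof (intro conjI allI impI ballI; (elim conjE)?)
  have dim: "n + 2 = DIM('a) + 1" using assms(2) by simp
  have I: "finite {1..n+2}" "card {1..n+2} = DIM('a) + 1" using assms(2) by auto
  show "\<exists>\<F> :: 'a set set. finite \<F> \<and> card \<F> = n + 2 \<and>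
      (\<forall>A\<in>\<F>. short_closed A) \<and> \<Union>\<F> = sphere 0 1"
    unfolding dim by (rule exists_short_closed_cover)
  show "\<Union>\<F> \<noteq> sphere 0 1"
    if "finite \<F>" "card \<F> < n + 2" "\<forall>A\<in>\<F>. short_closed A" for \<F> :: "'a set set"
    using short_closed_cover_card[of \<F>] that dim by auto
  fix F :: "nat \<Rightarrow> 'a set"
  show "(\<Union>i\<in>{1..n+2}. F i) = sphere 0 1"
    if "\<forall>i\<in>{1..n+2}. cap (F i)" "(\<Inter>i\<in>{1..n+2}. F i) = {}"
      "\<forall>j\<in>{1..n+2}. (\<Inter>i\<in>{1..n+2} - {j}. F i) \<noteq> {}"
    using that by (intro caps_cover_sphere I) auto
  assume F: "\<forall>i\<in>{1..n+2}. short_closed (F i)" "(\<Union>i\<in>{1..n+2}. F i) = sphere 0 1"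
  then have short: "\<And>i. i \<in> {1..n+2} \<Longrightarrow> short_closed (F i)" by blast
  show "(\<Inter>i\<in>{1..n+2}. F i) = {}"
    by (rule short_closed_cover_Int_empty[where F = F, OF short F(2)])
  show "(\<Inter>i\<in>{1..n+2} - {j}. F i) \<noteq> {}" if "j \<in> {1..n+2}" for j
    by (rule short_closed_cover_Int_all_but_one[where F = F, OF I short F(2) that])
  fix a :: "nat \<Rightarrow> 'a"
  assume "\<forall>j\<in>{1..n+2}. a j \<in> (\<Inter>i\<in>{1..n+2} - {j}. F i)"
  then have a: "\<And>j. j \<in> {1..n+2} \<Longrightarrow> a j \<in> (\<Inter>i\<in>{1..n+2} - {j}. F i)" by blast
  note simplex = short_closed_cover_simplex[where F = F and a = a, OF I short F(2) a]
  show "inj_on a {1..n+2}" by (rule simplex(1))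
  show "\<not> affine_dependent (a ` {1..n+2})" by (rule simplex(2))
  show "int (n + 1) simplex (convex hull (a ` {1..n+2}))"
    using simplex(3) unfolding assms(2) .
  show "0 \<in> interior (convex hull (a ` {1..n+2}))" by (rule simplex(4))
qed

end
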